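(* Let $N,M,Q\ge 1$. The following are true: (i) if $\mathscr{A},\mathscr{B}\in\mathcal{H}(N,M)$, then $\mathscr{A}+\mathscr{B}\in\mathcal{H}(N,M)$; (ii) if $\mathscr{A}\in\mathcal{H}(N,M)$ and $\mathscr{B}\in\mathcal{H}(M,Q)$, then $\mathscr{A}\mathscr{B}\in\mathcal{H}(N,Q)$; (iii) if $t>0$ is a real number and $\mathscr{A}\in\mathcal{H}(N,M)$, then $t\mathscr{A}=\mathscr{A}t\in\mathcal{H}(N,M)$.
   Context: For vectors (or matrices) $x,y$ of the same size, $x\ge y$ (resp. $x>y$) means that every entry of $x$ is not less than (resp. strictly greater than) the corresponding entry of $y$; a matrix $A$ is positive if $A>0$. A set $\mathscr{A}$ of positive real $N\times M$ matrices is called an $\mathcal{H}$-set (hourglass set) if, whenever $\tilde{A}u=v$ for some $\tilde{A}\in\mathscr{A}$ and vectors $u\in\mathbb{R}^M$, $v\in\mathbb{R}^N$ with $u,v>0$, both of the following hold: H1: either $Au\ge v$ for all $A\in\mathscr{A}$, or there exists $\bar{A}\in\mathscr{A}$ such that $\bar{A}u\le v$ and $\bar{A}u\ne v$; H2: either $Au\le v$ for all $A\in\mathscr{A}$, or there exists $\bar{A}\in\mathscr{A}$ such that $\bar{A}u\ge v$ and $\bar{A}u\ne v$. $\mathcal{H}(N,M)$ denotes the collection of all compact $\mathcal{H}$-sets of positive real $N\times M$ matrices (compact as subsets of $\mathbb{R}^{N\times M}$). Minkowski operations: $\mathscr{A}+\mathscr{B}=\{A+B: A\in\mathscr{A},\,B\in\mathscr{B}\}$,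 $\mathscr{A}\mathscr{B}=\{AB: A\in\mathscr{A},\,B\in\mathscr{B}\}$, $t\mathscr{A}=\mathscr{A}t=\{tA: A\in\mathscr{A}\}$. *)

theory Defs
  imports "HOL-Analysis.Analysis"
begin

text \<open>
  The library order \<open>\<le>\<close> on \<open>real ^ 'n\<close> is the entrywise one, but the library \<open><\<close> is only its strict
  part (\<open>x \<le> y \<and> \<not> y \<le> x\<close>).  The entrywise strict orders are therefore introduced separately.
  An \<open>N \<times> M\<close> matrix has type \<open>real ^ 'm ^ 'n\<close> with \<open>CARD('n) = N\<close> and \<open>CARD('m) = M\<close>.
\<close>

definition vec_less :: "real ^ 'n \<Rightarrow> real ^ 'n \<Rightarrow> bool"  (infix "<\<^sub>v" 50)
  where "x <\<^sub>v y \<longleftrightarrow> (\<forall>i. x $ i < y $ i)"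

definition mat_less :: "real ^ 'm ^ 'n \<Rightarrow> real ^ 'm ^ 'n \<Rightarrow> bool"  (infix "<\<^sub>m" 50)
  where "A <\<^sub>m B \<longleftrightarrow> (\<forall>i j. A $ i $ j < B $ i $ j)"

definition H1 :: "(real ^ 'm ^ 'n) set \<Rightarrow> real ^ 'm \<Rightarrow> real ^ 'n \<Rightarrow> bool"
  where "H1 \<A> u v \<longleftrightarrow>
    (\<forall>A\<in>\<A>. A *v u \<ge> v) \<or> (\<exists>A'\<in>\<A>. A' *v u \<le> v \<and> A' *v u \<noteq> v)"

definition H2 :: "(real ^ 'm ^ 'n) set \<Rightarrow> real ^ 'm \<Rightarrow> real ^ 'n \<Rightarrow> bool"
  where "H2 \<A> u v \<longleftrightarrow>
    (\<forall>A\<in>\<A>. A *v u \<le> v) \<or> (\<exists>A'\<in>\<A>. A' *v u \<ge> v \<and> A' *v u \<noteq> v)"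

definition hourglass_set :: "(real ^ 'm ^ 'n) set \<Rightarrow> bool"
  where "hourglass_set \<A> \<longleftrightarrow>
    (\<forall>A\<in>\<A>. 0 <\<^sub>m A) \<and>
    (\<forall>A\<in>\<A>. \<forall>u v. 0 <\<^sub>v u \<and> 0 <\<^sub>v v \<and> A *v u = v \<longrightarrow> H1 \<A> u v \<and> H2 \<A> u v)"

definition compact_hourglass_sets :: "(real ^ 'm ^ 'n) set set"
  where "compact_hourglass_sets = {\<A>. compact \<A> \<and> hourglass_set \<A>}"

text \<open>
  Minkowski sums of sets of matrices are the sums \<open>\<A> + \<B>\<close> of \<open>HOL-Library.Set_Algebras\<close>.  The product
  of sets from that theory is not used: it would lift the entrywise product \<open>*\<close>, not the matrix
  product \<open>**\<close>.
\<close>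

definition set_mat_mult :: "(real ^ 'm ^ 'n) set \<Rightarrow> (real ^ 'q ^ 'm) set \<Rightarrow> (real ^ 'q ^ 'n) set"
    (infixl "\<otimes>\<^sub>m" 70)
  where "\<A> \<otimes>\<^sub>m \<B> = {A ** B | A B. A \<in> \<A> \<and> B \<in> \<B>}"

definition scale_set_left :: "real \<Rightarrow> (real ^ 'm ^ 'n) set \<Rightarrow> (real ^ 'm ^ 'n) set"
  where "scale_set_left t \<A> = {t *\<^sub>R A | A. A \<in> \<A>}"

definition scale_set_right :: "(real ^ 'm ^ 'n) set \<Rightarrow> real \<Rightarrow> (real ^ 'm ^ 'n) set"
  where "scale_set_right \<A> t = {(\<chi> i j. A $ i $ j * t) | A. A \<in> \<A>}"

end

(*
  For a nonempty compact set \<A> of positive matrices, the alternatives H1 and H2 hold iff for every u > 0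
  the image {A u : A \<in> \<A>} has a least and a greatest element: a matrix that minimizes (maximizes)
  the sum of the entries of A u can only satisfy the first branch of the alternative.  Least and
  greatest elements of the images are preserved by the Minkowski operations, since a positive
  matrix acts monotonically and maps positive vectors to positive vectors.
*)
theory Submission
  imports Defs
begin

text \<open>The extremes are named by matrices of the set rather than by vectors of the image, so
  that they can be added, multiplied and scaled to give witnesses for the Minkowski operations. They
  may depend on \<open>u\<close>.\<close>

definition has_extremes :: "(real ^ 'm ^ 'n) set \<Rightarrow> real ^ 'm \<Rightarrow> bool"
  where "has_extremes \<A> u \<longleftrightarrow>
    (\<exists>L\<in>\<A>. \<forall>A\<in>\<A>. L *v u \<le> A *v u) \<and> (\<exists>G\<in>\<A>. \<forall>A\<in>\<A>. A *v u \<le> G *v u)"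

lemma has_extremesE:
  assumes "has_extremes \<A> u"
  obtains L G where "L \<in> \<A>" "\<And>A. A \<in> \<A> \<Longrightarrow> L *v u \<le> A *v u"
    and "G \<in> \<A>" "\<And>A. A \<in> \<A> \<Longrightarrow> A *v u \<le> G *v u"
  using assms unfolding has_extremes_def by blast

text \<open>Supplies a real functional that is strictly monotone for the partial entrywise order: a
  vector minimizing it over a set has no element of the set strictly below it.\<close>

lemma sum_nth_strict_mono:
  fixes v w :: "real ^ 'n"
  assumes "v \<le> w" "v \<noteq> w"
  shows "(\<Sum>i\<in>UNIV. v $ i) < (\<Sum>i\<in>UNIV. w $ i)"
proof (rule sum_strict_mono_ex1)
  show "\<forall>i\<in>UNIV. v $ i \<le> w $ i"
    using assms(1) by (simp add: less_eq_vec_def)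
  show "\<exists>i\<in>UNIV. v $ i < w $ i"
    using assms by (metis UNIV_I less_eq_vec_def order_le_less vec_eq_iff)
qed simp

text \<open>Each entry is a sum of positive terms over an index type, which is never empty; hence
  strictness survives.\<close>

lemma matrix_vector_mult_pos:
  assumes "0 <\<^sub>m A" "0 <\<^sub>v u"
  shows "0 <\<^sub>v A *v u"
  using assms by (auto simp: vec_less_def mat_less_def matrix_vector_mult_def intro!: sum_pos)

lemma matrix_vector_mult_mono:
  assumes "0 <\<^sub>m A" "u \<le> w"
  shows "A *v u \<le> A *v w"
  using assms
  by (auto simp: less_eq_vec_def mat_less_def matrix_vector_mult_def less_imp_le
      intro!: sum_mono mult_left_mono)

lemma matrix_add_pos: "0 <\<^sub>m A \<Longrightarrow> 0 <\<^sub>m B \<Longrightarrow> 0 <\<^sub>m A + B"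
  by (simp add: mat_less_def add_pos_pos)

lemma matrix_mult_pos: "0 <\<^sub>m A \<Longrightarrow> 0 <\<^sub>m B \<Longrightarrow> 0 <\<^sub>m A ** B"
  by (auto simp: mat_less_def matrix_matrix_mult_def intro!: sum_pos)

lemma matrix_scaleR_pos: "0 < t \<Longrightarrow> 0 <\<^sub>m A \<Longrightarrow> 0 <\<^sub>m t *\<^sub>R A"
  by (simp add: mat_less_def)

lemma compact_hourglass_has_extremes:
  fixes \<A> :: "(real ^ 'm ^ 'n) set"
  assumes "compact \<A>" "hourglass_set \<A>" "\<A> \<noteq> {}" "0 <\<^sub>v u"
  shows "has_extremes \<A> u"
proof -
  define f where "f A = (\<Sum>i\<in>UNIV. (A *v u) $ i)" for A :: "real ^ 'm ^ 'n"
  have cont: "continuous_on \<A> f"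
    unfolding f_def matrix_vector_mult_def by (auto intro!: continuous_intros)
  \<comment> \<open>Both alternatives are available at every \<open>v = A *v u\<close>, because
    positivity of \<open>A\<close> and \<open>u\<close> makes this vector positive.\<close>
  have alt: "H1 \<A> u (A *v u) \<and> H2 \<A> u (A *v u)" if "A \<in> \<A>" for A
    using assms(2,4) that matrix_vector_mult_pos unfolding hourglass_set_def by blast
  have f_mono: "f A < f B" if "A *v u \<le> B *v u" "A *v u \<noteq> B *v u" for A B
    unfolding f_def using that by (rule sum_nth_strict_mono)
  obtain L where L: "L \<in> \<A>" "\<forall>A\<in>\<A>. f L \<le> f A"
    using continuous_attains_inf[OF assms(1,3) cont] by blast
  obtain G where G: "G \<in> \<A>" "\<forall>A\<in>\<A>. f A \<le> f G"
    using continuous_attains_sup[OF assms(1,3) cont] by blast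
  have "\<forall>A\<in>\<A>. L *v u \<le> A *v u"
    using alt[OF L(1)] L(2) f_mono unfolding H1_def by (meson leD)
  moreover have "\<forall>A\<in>\<A>. A *v u \<le> G *v u"
    using alt[OF G(1)] G(2) f_mono unfolding H2_def by (metis leD)
  ultimately show ?thesis
    unfolding has_extremes_def using L(1) G(1) by blast
qed

text \<open>Compare \<open>A *v u\<close> with the extremes at \<open>u\<close>. If it equals
  \<open>L *v u\<close>, the first branch of \<open>H1\<close> holds; otherwise \<open>L\<close>
  itself witnesses the second branch. \<open>G\<close> does the same for \<open>H2\<close>.\<close>

lemma hourglass_setI:
  assumes pos: "\<And>A. A \<in> \<A> \<Longrightarrow> 0 <\<^sub>m A"
    and ext: "\<And>u. \<A> \<noteq> {} \<Longrightarrow> 0 <\<^sub>v u \<Longrightarrow> has_extremes \<A> u"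
  shows "hourglass_set \<A>"
proof -
  have "H1 \<A> u (A *v u) \<and> H2 \<A> u (A *v u)" if A: "A \<in> \<A>" and u: "0 <\<^sub>v u" for A u
  proof -
    from A have "\<A> \<noteq> {}" by blast
    from ext[OF this u] obtain L G where "L \<in> \<A>" "\<And>A. A \<in> \<A> \<Longrightarrow> L *v u \<le> A *v u"
      and "G \<in> \<A>" "\<And>A. A \<in> \<A> \<Longrightarrow> A *v u \<le> G *v u"
      by (rule has_extremesE) blast
    with A show ?thesis
      unfolding H1_def H2_def by metis
  qed
  with pos show ?thesis
    unfolding hourglass_set_def by blast
qed

text \<open>The nonemptiness guard is essential: the empty set is vacuously a compact hourglass set,
  yet it has no extremes.\<close>

lemma compact_hourglass_sets_iff:
  "\<A> \<in> compact_hourglass_sets \<longleftrightarrow>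
    compact \<A> \<and> (\<forall>A\<in>\<A>. 0 <\<^sub>m A) \<and> (\<A> \<noteq> {} \<longrightarrow> (\<forall>u. 0 <\<^sub>v u \<longrightarrow> has_extremes \<A> u))"
  using compact_hourglass_has_extremes hourglass_setI
  by (auto simp: compact_hourglass_sets_def) (auto simp: hourglass_set_def)

lemma compact_set_mat_mult:
  assumes "compact \<A>" "compact \<B>"
  shows "compact (\<A> \<otimes>\<^sub>m \<B>)"
proof -
  have "\<A> \<otimes>\<^sub>m \<B> = (\<lambda>(A, B). A ** B) ` (\<A> \<times> \<B>)"
    by (auto simp: set_mat_mult_def)
  moreover have "continuous_on (\<A> \<times> \<B>) (\<lambda>(A, B). A ** B)"
    unfolding matrix_matrix_mult_def case_prod_unfold by (auto intro!: continuous_intros)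
  ultimately show ?thesis
    using assms by (simp add: compact_continuous_image compact_Times)
qed

lemma compact_hourglass_sets_plus:
  fixes \<A> \<B> :: "(real ^ 'm ^ 'n) set"
  assumes A: "\<A> \<in> compact_hourglass_sets" and B: "\<B> \<in> compact_hourglass_sets"
  shows "\<A> + \<B> \<in> compact_hourglass_sets"
  unfolding compact_hourglass_sets_iff
proof (intro conjI impI allI ballI)
  have "\<A> + \<B> = {A + B | A B. A \<in> \<A> \<and> B \<in> \<B>}"
    by (auto simp: set_plus_def)
  with A B show "compact (\<A> + \<B>)"
    by (simp add: compact_hourglass_sets_iff compact_sums)
next
  fix C assume "C \<in> \<A> + \<B>"
  with A B show "0 <\<^sub>m C"
    by (auto simp: compact_hourglass_sets_iff set_plus_def matrix_add_pos)
next
  fix u :: "real ^ 'm" assume "\<A> + \<B> \<noteq> {}" and u: "0 <\<^sub>v u"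
  then have "\<A> \<noteq> {}" "\<B> \<noteq> {}"
    by (auto simp: set_plus_def)
  with A B u have "has_extremes \<A> u" "has_extremes \<B> u"
    by (auto simp: compact_hourglass_sets_iff)
  then obtain L G L' G' where "L \<in> \<A>" "\<And>A. A \<in> \<A> \<Longrightarrow> L *v u \<le> A *v u"
    and "G \<in> \<A>" "\<And>A. A \<in> \<A> \<Longrightarrow> A *v u \<le> G *v u"
    and "L' \<in> \<B>" "\<And>B. B \<in> \<B> \<Longrightarrow> L' *v u \<le> B *v u"
    and "G' \<in> \<B>" "\<And>B. B \<in> \<B> \<Longrightarrow> B *v u \<le> G' *v u"
    by (elim has_extremesE) blast
  \<comment> \<open>All four extremes belong to the same \<open>u\<close>, so the two inequalities
    for the summands can be added.\<close>
  then have "L + L' \<in> \<A> + \<B>" "\<forall>C\<in>\<A> + \<B>. (L + L') *v u \<le> C *v u"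
    and "G + G' \<in> \<A> + \<B>" "\<forall>C\<in>\<A> + \<B>. C *v u \<le> (G + G') *v u"
    by (auto simp: set_plus_def matrix_vector_mult_add_rdistrib intro!: add_mono)
  then show "has_extremes (\<A> + \<B>) u"
    unfolding has_extremes_def by blast
qed

lemma compact_hourglass_sets_mult:
  fixes \<A> :: "(real ^ 'm ^ 'n) set" and \<B> :: "(real ^ 'q ^ 'm) set"
  assumes A: "\<A> \<in> compact_hourglass_sets" and B: "\<B> \<in> compact_hourglass_sets"
  shows "\<A> \<otimes>\<^sub>m \<B> \<in> compact_hourglass_sets"
  unfolding compact_hourglass_sets_iff
proof (intro conjI impI allI ballI)
  show "compact (\<A> \<otimes>\<^sub>m \<B>)"
    using A B by (simp add: compact_hourglass_sets_iff compact_set_mat_mult)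
next
  fix C assume "C \<in> \<A> \<otimes>\<^sub>m \<B>"
  with A B show "0 <\<^sub>m C"
    by (auto simp: compact_hourglass_sets_iff set_mat_mult_def matrix_mult_pos)
next
  fix u :: "real ^ 'q" assume "\<A> \<otimes>\<^sub>m \<B> \<noteq> {}" and u: "0 <\<^sub>v u"
  then have ne: "\<A> \<noteq> {}" "\<B> \<noteq> {}"
    by (auto simp: set_mat_mult_def)
  have posA: "0 <\<^sub>m X" if "X \<in> \<A>" for X
    using A that by (simp add: compact_hourglass_sets_iff)
  have posB: "0 <\<^sub>m Y" if "Y \<in> \<B>" for Y
    using B that by (simp add: compact_hourglass_sets_iff)
  have "has_extremes \<B> u"
    using B u ne by (simp add: compact_hourglass_sets_iff)
  then obtain L' G' where L': "L' \<in> \<B>" "\<And>Y. Y \<in> \<B> \<Longrightarrow> L' *v u \<le> Y *v u"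
    and G': "G' \<in> \<B>" "\<And>Y. Y \<in> \<B> \<Longrightarrow> Y *v u \<le> G' *v u"
    by (rule has_extremesE) blast
  \<comment> \<open>The left factor acts on \<open>Y *v u\<close>, not on \<open>u\<close>, so its
    extremes are needed there. Hence \<open>L'\<close> and \<open>G'\<close> are chosen first, and
    \<open>L\<close> and \<open>G\<close> afterwards at \<open>L' *v u\<close> and
    \<open>G' *v u\<close>.\<close>
  have extA: "has_extremes \<A> (Y *v u)" if "Y \<in> \<B>" for Y
    using A ne matrix_vector_mult_pos[OF posB[OF that] u] by (simp add: compact_hourglass_sets_iff)
  obtain L where L: "L \<in> \<A>" "\<And>X. X \<in> \<A> \<Longrightarrow> L *v (L' *v u) \<le> X *v (L' *v u)"
    using extA[OF L'(1)] by (rule has_extremesE) blast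
  obtain G where G: "G \<in> \<A>" "\<And>X. X \<in> \<A> \<Longrightarrow> X *v (G' *v u) \<le> G *v (G' *v u)"
    using extA[OF G'(1)] by (rule has_extremesE) blast
  \<comment> \<open>The lower bound is the chain \<open>L *v (L' *v u)\<close> \<le>
    \<open>X *v (L' *v u)\<close> \<le> \<open>X *v (Y *v u)\<close>: first the choice of
    \<open>L\<close>, then monotonicity of the positive matrix \<open>X\<close>. The upper bound is
    dual.\<close>
  have "(L ** L') *v u \<le> (X ** Y) *v u" "(X ** Y) *v u \<le> (G ** G') *v u"
    if "X \<in> \<A>" "Y \<in> \<B>" for X Y
    using L(2)[OF that(1)] matrix_vector_mult_mono[OF posA[OF that(1)] L'(2)[OF that(2)]]
      G(2)[OF that(1)] matrix_vector_mult_mono[OF posA[OF that(1)] G'(2)[OF that(2)]]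
    unfolding matrix_vector_mul_assoc[symmetric] by (blast intro: order_trans)+
  with L(1) L'(1) G(1) G'(1) show "has_extremes (\<A> \<otimes>\<^sub>m \<B>) u"
    unfolding has_extremes_def set_mat_mult_def by blast
qed

lemma scale_set_left_eq_right:
  fixes \<A> :: "(real ^ 'm ^ 'n) set"
  shows "scale_set_left t \<A> = scale_set_right \<A> t"
proof -
  have "t *\<^sub>R A = (\<chi> i j. A $ i $ j * t)" for A :: "real ^ 'm ^ 'n"
    by (simp add: vec_eq_iff mult.commute)
  then show ?thesis
    unfolding scale_set_left_def scale_set_right_def by simp
qed

lemma compact_hourglass_sets_scale:
  fixes \<A> :: "(real ^ 'm ^ 'n) set"
  assumes t: "0 < t" and A: "\<A> \<in> compact_hourglass_sets"
  shows "scale_set_left t \<A> \<in> compact_hourglass_sets"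
proof -
  have eq: "scale_set_left t \<A> = (*\<^sub>R) t ` \<A>"
    by (auto simp: scale_set_left_def)
  have mono: "(t *\<^sub>R X) *v u \<le> (t *\<^sub>R Y) *v u" if "X *v u \<le> Y *v u" for X Y :: "real ^ 'm ^ 'n" and u
    using that t by (simp add: scaleR_matrix_vector_assoc[symmetric] less_eq_vec_def)
  \<comment> \<open>If \<open>L\<close> and \<open>G\<close> are extremal for \<A> at
    \<open>u\<close>, then \<open>t *\<^sub>R L\<close> and \<open>t *\<^sub>R G\<close> are
    extremal for the scaled set at the same \<open>u\<close>.\<close>
  have "has_extremes ((*\<^sub>R) t ` \<A>) u" if "has_extremes \<A> u" for u
    using that mono unfolding has_extremes_def by blast
  with A t show ?thesis
    unfolding eq compact_hourglass_sets_iff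
    by (auto simp: compact_scaling matrix_scaleR_pos)
qed

theorem theorem2:
  shows "(\<forall>(\<A> :: (real ^ 'm ^ 'n) set) (\<B> :: (real ^ 'm ^ 'n) set).
            \<A> \<in> compact_hourglass_sets \<and> \<B> \<in> compact_hourglass_sets
            \<longrightarrow> \<A> + \<B> \<in> compact_hourglass_sets) \<and>
         (\<forall>(\<A> :: (real ^ 'm ^ 'n) set) (\<B> :: (real ^ 'q ^ 'm) set).
            \<A> \<in> compact_hourglass_sets \<and> \<B> \<in> compact_hourglass_sets
            \<longrightarrow> \<A> \<otimes>\<^sub>m \<B> \<in> compact_hourglass_sets) \<and>
         (\<forall>(t :: real) (\<A> :: (real ^ 'm ^ 'n) set).
            t > 0 \<and> \<A> \<in> compact_hourglass_sets
            \<longrightarrow> scale_set_left t \<A> = scale_set_right \<A> t \<and>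
                scale_set_left t \<A> \<in> compact_hourglass_sets)"
  using compact_hourglass_sets_plus compact_hourglass_sets_mult compact_hourglass_sets_scale
    scale_set_left_eq_right
  by blast

end
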